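(* Let $\underline P$ be a finitely generated coherent lower prevision on gambles on a finite set $\mathcal X$ with $n$ elements, with credal set $\mathcal M(\underline P)$, let $P\in\mathcal M(\underline P)$, and let $g,h\in N(\underline P,P)$ be arbitrary vectors in the normal cone at $P$. Then $\underline P(g+h)=\underline P(g)+\underline P(h)$.
   Context: Gambles are real functions on $\mathcal X$, identified with $\mathbb R^n$. A linear prevision is an expectation functional $P(f)=\sum_{x}p(x)f(x)$ for a probability mass vector $p$. A finitely generated coherent lower prevision is a map $\underline P\colon\mathcal F\to\mathbb R$ on a finite set $\mathcal F\subset\mathbb R^n$ such that its credal set $\mathcal M(\underline P)=\{P\text{ linear prevision}\colon P(f)\ge\underline P(f)\ \forall f\in\mathcal F\}$ is nonempty and $\underline P(f)=\min_{P\in\mathcal M(\underline P)}P(f)$ for all $f\in\mathcal F$. On all of $\mathbb R^n$, $\underline P$ denotes the natural extension $f\mapsto\min_{P\in\mathcal M(\underline P)}P(f)$. The normal cone at $P\in\mathcal M(\underline P)$ is $N(\underline P,P)=\{f\in\mathbb R^n\colon P(f)=\underline P(f)\}$. *)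

theory Defs
  imports "HOL-Analysis.Analysis"
begin

text \<open>
  The possibility space is a finite type \<open>'x\<close>, so \<open>n = CARD('x)\<close> and a gamble is a vector
  indexed by \<open>'x\<close>. Linear previsions are functionals on gambles, not mass vectors.
\<close>

type_synonym 'x gamble = "real ^ 'x"

definition mass_vector :: "real ^ 'x::finite \<Rightarrow> bool" where
  "mass_vector p \<longleftrightarrow> (\<forall>x. 0 \<le> p $ x) \<and> (\<Sum>x\<in>UNIV. p $ x) = 1"

definition linear_prevision :: "('x::finite gamble \<Rightarrow> real) \<Rightarrow> bool" where
  "linear_prevision P \<longleftrightarrow> (\<exists>p. mass_vector p \<and> (\<forall>f. P f = (\<Sum>x\<in>UNIV. p $ x * f $ x)))"

text \<open>
  An assessment is a set \<open>F\<close> of gambles together with a function \<open>L\<close>; in all definitions below only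
  the values of \<open>L\<close> on \<open>F\<close> matter.
\<close>

definition credal_set ::
    "'x::finite gamble set \<Rightarrow> ('x gamble \<Rightarrow> real) \<Rightarrow> ('x gamble \<Rightarrow> real) set" where
  "credal_set F L = {P. linear_prevision P \<and> (\<forall>f\<in>F. P f \<ge> L f)}"

text \<open>
  For a linear order, the least element satisfying the predicate is the minimum of the set, provided
  that it is attained; see \<open>credal_set_attains_min\<close> and \<open>natural_extension_min\<close> below.
\<close>

definition natural_extension ::
    "'x::finite gamble set \<Rightarrow> ('x gamble \<Rightarrow> real) \<Rightarrow> 'x gamble \<Rightarrow> real" where
  "natural_extension F L f = (LEAST v. v \<in> (\<lambda>P. P f) ` credal_set F L)"

definition fg_coherent_lower_prevision ::
    "'x::finite gamble set \<Rightarrow> ('x gamble \<Rightarrow> real) \<Rightarrow> bool" where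
  "fg_coherent_lower_prevision F L \<longleftrightarrow>
     finite F \<and> credal_set F L \<noteq> {} \<and> (\<forall>f\<in>F. L f = natural_extension F L f)"

definition normal_cone ::
    "'x::finite gamble set \<Rightarrow> ('x gamble \<Rightarrow> real) \<Rightarrow> ('x gamble \<Rightarrow> real) \<Rightarrow> 'x gamble set" where
  "normal_cone F L P = {f. P f = natural_extension F L f}"

lemma credal_set_attains_min:
  fixes F :: "'x::finite gamble set"
  assumes "credal_set F L \<noteq> {}"
  shows "\<exists>P\<in>credal_set F L. \<forall>Q\<in>credal_set F L. P f \<le> Q f"
proof -
  define ev :: "real ^ 'x \<Rightarrow> 'x gamble \<Rightarrow> real" where "ev p f = (\<Sum>x\<in>UNIV. p $ x * f $ x)" for p f
  define K :: "(real ^ 'x) set" where "K = {p. mass_vector p \<and> (\<forall>f\<in>F. L f \<le> ev p f)}"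
  have img: "credal_set F L = ev ` K"
    by (auto simp: credal_set_def linear_prevision_def K_def ev_def fun_eq_iff image_iff)
  have cont: "continuous_on UNIV (\<lambda>p. ev p f)" for f
    unfolding ev_def by (intro continuous_intros)
  have K_eq: "K = (\<Inter>x. {p. 0 \<le> p $ x}) \<inter> {p. (\<Sum>x\<in>UNIV. p $ x) = 1} \<inter> (\<Inter>f\<in>F. {p. L f \<le> ev p f})"
    by (auto simp: K_def mass_vector_def)
  have "closed K"
    unfolding K_eq
    by (intro closed_Int closed_INT ballI closed_Collect_le closed_Collect_eq cont continuous_intros)
  moreover have "bounded K"
  proof (rule boundedI)
    fix p assume "p \<in> K"
    then have p: "\<And>x. 0 \<le> p $ x" "(\<Sum>x\<in>UNIV. p $ x) = 1"
      by (auto simp: K_def mass_vector_def)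
    have "norm p \<le> (\<Sum>x\<in>UNIV. \<bar>p $ x\<bar>)"
      by (rule norm_le_l1_cart)
    then show "norm p \<le> 1"
      using p by simp
  qed
  ultimately have "compact K"
    by (simp add: compact_eq_bounded_closed)
  moreover have "K \<noteq> {}"
    using assms img by auto
  ultimately obtain p where "p \<in> K" "\<forall>q\<in>K. ev p f \<le> ev q f"
    using continuous_attains_inf[of K "\<lambda>p. ev p f"] continuous_on_subset[OF cont] by blast
  then show ?thesis
    unfolding img by blast
qed

lemma natural_extension_min:
  assumes "credal_set F L \<noteq> {}"
  shows "\<exists>P\<in>credal_set F L. P f = natural_extension F L f"
    and "\<And>Q. Q \<in> credal_set F L \<Longrightarrow> natural_extension F L f \<le> Q f"
proof -
  obtain P where P: "P \<in> credal_set F L" "\<forall>Q\<in>credal_set F L. P f \<le> Q f"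
    using credal_set_attains_min[OF assms] by blast
  then have "natural_extension F L f = P f"
    unfolding natural_extension_def by (intro Least_equality) auto
  with P show "\<exists>P\<in>credal_set F L. P f = natural_extension F L f"
    and "\<And>Q. Q \<in> credal_set F L \<Longrightarrow> natural_extension F L f \<le> Q f"
    by auto
qed

end

theory Submission
  imports Defs
begin

text \<open>The natural extension is a lower envelope of linear functionals, hence superadditive.
  Equality can fail only because different members of the credal set may minimise at
  \<open>g\<close> and at \<open>h\<close>; membership of both in the normal cone makes the single
  \<open>P\<close> a minimiser for each, and its additivity gives the reverse bound. Both directions
  rest on \<open>natural_extension_min\<close>: the envelope is a lower bound that is
  attained.\<close>

lemma linear_prevision_add:
  assumes "linear_prevision P"
  shows "P (f + g) = P f + P g"
  using assms by (auto simp: linear_prevision_def distrib_left sum.distrib)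

theorem proposition6:
  fixes F :: "'x::finite gamble set"
    and L P :: "'x gamble \<Rightarrow> real"
    and g h :: "'x gamble"
  assumes "fg_coherent_lower_prevision F L"
    and "P \<in> credal_set F L"
    and "g \<in> normal_cone F L P"
    and "h \<in> normal_cone F L P"
  shows "natural_extension F L (g + h) = natural_extension F L g + natural_extension F L h"
proof (rule antisym)
  have ne: "credal_set F L \<noteq> {}"
    using assms(2) by blast
  have add: "Q (g + h) = Q g + Q h" if "Q \<in> credal_set F L" for Q
    using that linear_prevision_add by (auto simp: credal_set_def)
  \<comment> \<open>The only direction that uses the normal cone: \<open>P\<close> attains the
    minimum at \<open>g\<close> and at \<open>h\<close> simultaneously.\<close>
  have "natural_extension F L (g + h) \<le> P (g + h)"
    using natural_extension_min(2)[OF ne assms(2)] .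
  also have "\<dots> = natural_extension F L g + natural_extension F L h"
    using add[OF assms(2)] assms(3,4) by (simp add: normal_cone_def)
  finally show "natural_extension F L (g + h) \<le> natural_extension F L g + natural_extension F L h" .
  \<comment> \<open>Superadditivity, valid for any two gambles: a minimiser \<open>Q\<close> at
    \<open>g + h\<close> lies above the envelope at each summand.\<close>
  obtain Q where Q: "Q \<in> credal_set F L" "Q (g + h) = natural_extension F L (g + h)"
    using natural_extension_min(1)[OF ne] by blast
  show "natural_extension F L g + natural_extension F L h \<le> natural_extension F L (g + h)"
    using natural_extension_min(2)[OF ne Q(1), of g] natural_extension_min(2)[OF ne Q(1), of h]
      add[OF Q(1)] Q(2) by linarith
qed

end
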